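(* Let $k\ge 1$ and $l\ge 0$ be integers, and let $W_\alpha$ be a $k$-hyponormal weighted shift with bounded weight sequence $\alpha=\{\alpha_n\}_{n\ge 0}$ of positive numbers. For $t\ge 0$ let $W_{\alpha(l,t)}$ be the weighted shift with weights $\alpha(l,t)_i=\alpha_i$ for $i\ne l$ and $\alpha(l,t)_l=t\alpha_l$. Then the set $$I^k=\{t\ge 0 \;:\; W_{\alpha(l,t)} \text{ is } k\text{-hyponormal}\}$$ is a nonempty bounded closed interval.
   Context: Given a bounded sequence of weights $\alpha=\{\alpha_n\}_{n\ge 0}$, the unilateral weighted shift $W_\alpha$ is the bounded operator on $\ell^2(\mathbb{N})$ ($\mathbb{N}=\{0,1,2,\dots\}$) with $W_\alpha e_n=\alpha_n e_{n+1}$ for all $n\ge 0$, where $\{e_n\}_{n\ge 0}$ is the canonical orthonormal basis; weights are positive, except that for $t=0$ the perturbed shift $W_{\alpha(l,0)}$ has $l$-th weight equal to $0$. For bounded operators, $[T,S]=TS-ST$. For an integer $k\ge 1$, a bounded operator $T$ on a Hilbert space $\mathcal{H}$ is $k$-hyponormal if the $k\times k$ operator matrix $M_k(T)=([T^{*j},T^i])_{1\le i,j\le k}$ (row index $i$, column index $j$), acting on $\mathcal{H}^k$, is positive semi-definite. An interval may be reduced to a single point. *)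

theory Defs
  imports "HOL-Analysis.Analysis"
begin

section \<open>Complex Hilbert spaces and bounded operators\<close>

text \<open>
  The norm, metric and topology of a complex inner product space are those of the underlying
  real inner product space, whose inner product is the real part of the complex one.
  The complex inner product is linear in the first and conjugate-linear in the second argument.
\<close>

class complex_inner = real_inner +
  fixes scaleC :: "complex \<Rightarrow> 'a \<Rightarrow> 'a" (infixr \<open>*\<^sub>C\<close> 75)
    and cinner :: "'a \<Rightarrow> 'a \<Rightarrow> complex"
  assumes scaleC_add_right: "c *\<^sub>C (x + y) = c *\<^sub>C x + c *\<^sub>C y"
    and scaleC_add_left: "(c + d) *\<^sub>C x = c *\<^sub>C x + d *\<^sub>C x"
    and scaleC_scaleC [simp]: "c *\<^sub>C d *\<^sub>C x = (c * d) *\<^sub>C x"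
    and scaleC_of_real: "complex_of_real r *\<^sub>C x = scaleR r x"
    and cinner_commute: "cinner x y = cnj (cinner y x)"
    and cinner_add_left: "cinner (x + y) z = cinner x z + cinner y z"
    and cinner_scaleC_left [simp]: "cinner (c *\<^sub>C x) y = c * cinner x y"
    and Re_cinner: "Re (cinner x y) = inner x y"

class chilbert_space = complex_inner + complete_space

definition bounded_clinear :: "('a::complex_inner \<Rightarrow> 'b::complex_inner) \<Rightarrow> bool" where
  "bounded_clinear T \<longleftrightarrow> bounded_linear T \<and> (\<forall>c x. T (c *\<^sub>C x) = c *\<^sub>C T x)"

definition cadjoint :: "('a::chilbert_space \<Rightarrow> 'a) \<Rightarrow> ('a \<Rightarrow> 'a)" where
  "cadjoint T = (THE S. \<forall>x y. cinner (T x) y = cinner x (S y))"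

lemma cadjoint_eqI:
  fixes T S :: "'a::chilbert_space \<Rightarrow> 'a"
  assumes "\<And>x y. cinner (T x) y = cinner x (S y)"
  shows "cadjoint T = S"
  unfolding cadjoint_def
proof (rule the_equality)
  show "\<forall>x y. cinner (T x) y = cinner x (S y)" using assms by blast
next
  fix R :: "'a \<Rightarrow> 'a" assume R: "\<forall>x y. cinner (T x) y = cinner x (R y)"
  show "R = S"
  proof
    fix y
    have "inner x (R y) = inner x (S y)" for x
      using R assms by (metis Re_cinner)
    then show "R y = S y" using vector_eq_ldot by blast
  qed
qed

section \<open>$k$-hyponormal operators\<close>

definition commutator :: "('a \<Rightarrow> 'a) \<Rightarrow> ('a \<Rightarrow> 'a) \<Rightarrow> 'a::ab_group_add \<Rightarrow> 'a" where
  "commutator T S = (\<lambda>x. T (S x) - S (T x))"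

text \<open>
  A \<open>k \<times> k\<close> operator matrix \<open>M\<close>, with row and column indices from \<open>1\<close> to \<open>k\<close>, acts on
  \<open>k\<close>-tuples \<open>x\<close> by \<open>(M x)\<^sub>i = (\<Sum>j. M\<^sub>i\<^sub>j x\<^sub>j)\<close>. Tuples are functions on \<^typ>\<open>nat\<close> of which only
  the values at \<open>1, \<dots>, k\<close> matter. Membership in \<open>\<real>\<^sub>\<ge>\<^sub>0\<close> says that a complex number is real and
  nonnegative.
\<close>

definition positive_semidefinite_matrix ::
    "nat \<Rightarrow> (nat \<Rightarrow> nat \<Rightarrow> 'a::complex_inner \<Rightarrow> 'a) \<Rightarrow> bool" where
  "positive_semidefinite_matrix k M \<longleftrightarrow>
     (\<forall>x :: nat \<Rightarrow> 'a. (\<Sum>i=1..k. cinner (\<Sum>j=1..k. M i j (x j)) (x i)) \<in> \<real>\<^sub>\<ge>\<^sub>0)"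

definition k_hyponormal :: "nat \<Rightarrow> ('a::chilbert_space \<Rightarrow> 'a) \<Rightarrow> bool" where
  "k_hyponormal k T \<longleftrightarrow> bounded_clinear T \<and>
     positive_semidefinite_matrix k (\<lambda>i j. commutator (cadjoint T ^^ j) (T ^^ i))"

section \<open>The Hilbert space of square-summable complex sequences\<close>

typedef ell2 = "{x :: nat \<Rightarrow> complex. summable (\<lambda>n. (cmod (x n))\<^sup>2)}"
  morphisms coord Abs_ell2
  by (rule exI[of _ "\<lambda>_. 0"]) simp

setup_lifting type_definition_ell2

lemma summable_coord: "summable (\<lambda>n. (cmod (coord x n))\<^sup>2)"
  using coord[of x] by simp

lemma ell2_eqI: "(\<And>n. coord x n = coord y n) \<Longrightarrow> x = y"
  by (meson coord_inject ext)

lemma square_summable_add: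
  fixes x y :: "nat \<Rightarrow> complex"
  assumes "summable (\<lambda>n. (cmod (x n))\<^sup>2)" "summable (\<lambda>n. (cmod (y n))\<^sup>2)"
  shows "summable (\<lambda>n. (cmod (x n + y n))\<^sup>2)"
proof (rule summable_comparison_test')
  show "summable (\<lambda>n. 2 * (cmod (x n))\<^sup>2 + 2 * (cmod (y n))\<^sup>2)"
    by (intro summable_add summable_mult assms)
next
  fix n
  have "(cmod (x n + y n))\<^sup>2 \<le> (cmod (x n) + cmod (y n))\<^sup>2"
    by (intro power_mono norm_triangle_ineq) auto
  also have "\<dots> \<le> 2 * (cmod (x n))\<^sup>2 + 2 * (cmod (y n))\<^sup>2"
    using sum_squares_bound[of "cmod (x n)" "cmod (y n)"] by (simp add: power2_sum)
  finally show "norm ((cmod (x n + y n))\<^sup>2) \<le> 2 * (cmod (x n))\<^sup>2 + 2 * (cmod (y n))\<^sup>2"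
    by simp
qed

lemma square_summable_mult:
  fixes x :: "nat \<Rightarrow> complex"
  assumes "summable (\<lambda>n. (cmod (x n))\<^sup>2)"
  shows "summable (\<lambda>n. (cmod (c * x n))\<^sup>2)"
  using summable_mult[OF assms, of "(cmod c)\<^sup>2"] by (simp add: norm_mult power_mult_distrib)

lemma summable_cinner:
  fixes x y :: "nat \<Rightarrow> complex"
  assumes "summable (\<lambda>n. (cmod (x n))\<^sup>2)" "summable (\<lambda>n. (cmod (y n))\<^sup>2)"
  shows "summable (\<lambda>n. x n * cnj (y n))"
proof (rule summable_comparison_test')
  show "summable (\<lambda>n. (cmod (x n))\<^sup>2 + (cmod (y n))\<^sup>2)"
    by (intro summable_add assms)
next
  fix n
  have "0 \<le> cmod (x n) * cmod (y n)" by simp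
  then have "cmod (x n) * cmod (y n) \<le> (cmod (x n))\<^sup>2 + (cmod (y n))\<^sup>2"
    using sum_squares_bound[of "cmod (x n)" "cmod (y n)"] by linarith
  then show "norm (x n * cnj (y n)) \<le> (cmod (x n))\<^sup>2 + (cmod (y n))\<^sup>2"
    by (simp add: norm_mult)
qed

lemma summable_coord_cinner: "summable (\<lambda>n. coord x n * cnj (coord y n))"
  by (rule summable_cinner[OF summable_coord summable_coord])

lemma suminf_coord_self:
  "(\<Sum>n. coord x n * cnj (coord x n)) = complex_of_real (\<Sum>n. (cmod (coord x n))\<^sup>2)"
  by (subst suminf_of_real[OF summable_coord]) (simp only: complex_norm_square)

instantiation ell2 :: real_inner
begin

lift_definition zero_ell2 :: ell2 is "\<lambda>_. 0" by simp
lift_definition plus_ell2 :: "ell2 \<Rightarrow> ell2 \<Rightarrow> ell2" is "\<lambda>x y n. x n + y n"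
  by (rule square_summable_add)
lift_definition uminus_ell2 :: "ell2 \<Rightarrow> ell2" is "\<lambda>x n. - x n" by simp
lift_definition minus_ell2 :: "ell2 \<Rightarrow> ell2 \<Rightarrow> ell2" is "\<lambda>x y n. x n - y n"
proof -
  fix x y :: "nat \<Rightarrow> complex"
  assume "summable (\<lambda>n. (cmod (x n))\<^sup>2)" "summable (\<lambda>n. (cmod (y n))\<^sup>2)"
  then show "summable (\<lambda>n. (cmod (x n - y n))\<^sup>2)"
    using square_summable_add[of x "\<lambda>n. - y n"] by simp
qed
lift_definition scaleR_ell2 :: "real \<Rightarrow> ell2 \<Rightarrow> ell2" is "\<lambda>r x n. complex_of_real r * x n"
  by (rule square_summable_mult)

definition inner_ell2 :: "ell2 \<Rightarrow> ell2 \<Rightarrow> real" where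
  "inner_ell2 x y = Re (\<Sum>n. coord x n * cnj (coord y n))"
definition norm_ell2 :: "ell2 \<Rightarrow> real" where
  "norm_ell2 x = sqrt (inner x x)"
definition sgn_ell2 :: "ell2 \<Rightarrow> ell2" where
  "sgn_ell2 x = scaleR (inverse (norm x)) x"
definition dist_ell2 :: "ell2 \<Rightarrow> ell2 \<Rightarrow> real" where
  "dist_ell2 x y = norm (x - y)"
definition uniformity_ell2 :: "(ell2 \<times> ell2) filter" where
  "uniformity_ell2 = (INF e\<in>{0<..}. principal {(x, y). dist x y < e})"
definition open_ell2 :: "ell2 set \<Rightarrow> bool" where
  "open_ell2 U \<longleftrightarrow> (\<forall>x\<in>U. eventually (\<lambda>(x', y). x' = x \<longrightarrow> y \<in> U) uniformity)"

instance
proof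
  fix x y z :: ell2 and r s :: real and U :: "ell2 set"
  note sm = summable_coord_cinner
  show "x + y + z = x + (y + z)" by transfer (simp add: algebra_simps)
  show "x + y = y + x" by transfer (simp add: algebra_simps)
  show "0 + x = x" by transfer simp
  show "- x + x = 0" by transfer simp
  show "x - y = x + - y" by transfer simp
  show "scaleR r (x + y) = scaleR r x + scaleR r y" by transfer (simp add: algebra_simps)
  show "scaleR (r + s) x = scaleR r x + scaleR s x" by transfer (simp add: algebra_simps)
  show "scaleR r (scaleR s x) = scaleR (r * s) x" by transfer (simp add: algebra_simps)
  show "scaleR 1 x = x" by transfer simp
  show "sgn x = scaleR (inverse (norm x)) x" by (rule sgn_ell2_def)
  show "dist x y = norm (x - y)" by (rule dist_ell2_def)
  show "uniformity = (INF e\<in>{0<..}. principal {(x :: ell2, y). dist x y < e})"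
    by (rule uniformity_ell2_def)
  show "open U \<longleftrightarrow> (\<forall>x\<in>U. eventually (\<lambda>(x', y). x' = x \<longrightarrow> y \<in> U) uniformity)"
    by (rule open_ell2_def)
  have "inner x y = Re (cnj (\<Sum>n. coord x n * cnj (coord y n)))"
    by (simp add: inner_ell2_def)
  also have "cnj (\<Sum>n. coord x n * cnj (coord y n)) = (\<Sum>n. coord y n * cnj (coord x n))"
    using bounded_linear.suminf[OF bounded_linear_cnj sm[of x y]] by (simp add: mult.commute)
  finally show "inner x y = inner y x" by (simp add: inner_ell2_def)
  show "inner (x + y) z = inner x z + inner y z"
    unfolding inner_ell2_def plus_ell2.rep_eq
    by (simp add: distrib_right suminf_add[OF sm sm, symmetric])
  have "(\<Sum>n. coord (scaleR r x) n * cnj (coord y n))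
      = complex_of_real r * (\<Sum>n. coord x n * cnj (coord y n))"
    unfolding scaleR_ell2.rep_eq
    by (subst suminf_mult[OF sm, symmetric]) (simp add: algebra_simps)
  then show "inner (scaleR r x) y = r * inner x y"
    by (simp add: inner_ell2_def)
  show "0 \<le> inner x x"
    by (simp add: inner_ell2_def suminf_coord_self suminf_nonneg[OF summable_coord])
  show "inner x x = 0 \<longleftrightarrow> x = 0"
  proof
    assume "inner x x = 0"
    then have "(\<Sum>n. (cmod (coord x n))\<^sup>2) = 0" by (simp add: inner_ell2_def suminf_coord_self)
    then have "coord x n = 0" for n
      using suminf_eq_zero_iff[OF summable_coord[of x]] by simp
    then show "x = 0" by (intro ell2_eqI) (simp add: zero_ell2.rep_eq)
  qed (simp add: inner_ell2_def zero_ell2.rep_eq)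
  show "norm x = sqrt (inner x x)" by (rule norm_ell2_def)
qed

end

instantiation ell2 :: complex_inner
begin

lift_definition scaleC_ell2 :: "complex \<Rightarrow> ell2 \<Rightarrow> ell2" is "\<lambda>c x n. c * x n"
  by (rule square_summable_mult)

definition cinner_ell2 :: "ell2 \<Rightarrow> ell2 \<Rightarrow> complex" where
  "cinner_ell2 x y = (\<Sum>n. coord x n * cnj (coord y n))"

instance
proof
  fix x y z :: ell2 and r :: real and c d :: complex
  note sm = summable_coord_cinner
  show "c *\<^sub>C (x + y) = c *\<^sub>C x + c *\<^sub>C y" by transfer (simp add: algebra_simps)
  show "(c + d) *\<^sub>C x = c *\<^sub>C x + d *\<^sub>C x" by transfer (simp add: algebra_simps)
  show "c *\<^sub>C d *\<^sub>C x = (c * d) *\<^sub>C x" by transfer (simp add: algebra_simps)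
  show "complex_of_real r *\<^sub>C x = scaleR r x" by transfer simp
  show "cinner x y = cnj (cinner y x)"
    unfolding cinner_ell2_def
    using bounded_linear.suminf[OF bounded_linear_cnj sm[of y x]] by (simp add: mult.commute)
  show "cinner (x + y) z = cinner x z + cinner y z"
    unfolding cinner_ell2_def plus_ell2.rep_eq
    by (subst suminf_add[OF sm sm]) (simp add: algebra_simps)
  show "cinner (c *\<^sub>C x) y = c * cinner x y"
    unfolding cinner_ell2_def scaleC_ell2.rep_eq
    by (subst suminf_mult[OF sm, symmetric]) (simp add: algebra_simps)
  show "Re (cinner x y) = inner x y" by (simp add: inner_ell2_def cinner_ell2_def)
qed

end

lemma norm_ell2_power2: "(norm x)\<^sup>2 = (\<Sum>n. (cmod (coord x n))\<^sup>2)" for x :: ell2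
  by (simp add: power2_norm_eq_inner inner_ell2_def suminf_coord_self)

lemma sum_coord_le_norm: "(\<Sum>n<N. (cmod (coord x n))\<^sup>2) \<le> (norm x)\<^sup>2" for x :: ell2
  unfolding norm_ell2_power2 by (rule sum_le_suminf[OF summable_coord]) auto

lemma cmod_coord_le_norm: "cmod (coord x n) \<le> norm x" for x :: ell2
proof -
  have "(cmod (coord x n))\<^sup>2 \<le> (\<Sum>n<Suc n. (cmod (coord x n))\<^sup>2)"
    by (rule member_le_sum) auto
  also have "\<dots> \<le> (norm x)\<^sup>2" by (rule sum_coord_le_norm)
  finally show ?thesis by (rule power2_le_imp_le) simp
qed

instance ell2 :: chilbert_space
proof
  fix X :: "nat \<Rightarrow> ell2"
  assume X: "Cauchy X"
  have "Cauchy (\<lambda>m. coord (X m) n)" for n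
  proof (rule metric_CauchyI)
    fix e :: real assume "0 < e"
    then obtain M where M: "\<And>p q. p \<ge> M \<Longrightarrow> q \<ge> M \<Longrightarrow> dist (X p) (X q) < e"
      using metric_CauchyD[OF X] by blast
    have "dist (coord (X p) n) (coord (X q) n) \<le> dist (X p) (X q)" for p q
      using cmod_coord_le_norm[of "X p - X q" n] by (simp add: dist_norm minus_ell2.rep_eq)
    then show "\<exists>M. \<forall>p\<ge>M. \<forall>q\<ge>M. dist (coord (X p) n) (coord (X q) n) < e"
      using M by (meson le_less_trans)
  qed
  then have "(\<lambda>m. coord (X m) n) \<longlonglongrightarrow> lim (\<lambda>m. coord (X m) n)" for n
    by (simp add: Cauchy_convergent_iff convergent_LIMSEQ_iff)
  then obtain L where L: "\<And>n. (\<lambda>m. coord (X m) n) \<longlonglongrightarrow> L n"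
    by (rule that)
  have bound: "\<exists>M. \<forall>p\<ge>M. \<forall>N. (\<Sum>n<N. (cmod (coord (X p) n - L n))\<^sup>2) \<le> e\<^sup>2"
    if "0 < e" for e :: real
  proof -
    obtain M where M: "\<And>p q. p \<ge> M \<Longrightarrow> q \<ge> M \<Longrightarrow> dist (X p) (X q) < e"
      using metric_CauchyD[OF X \<open>0 < e\<close>] by blast
    have "(\<Sum>n<N. (cmod (coord (X p) n - L n))\<^sup>2) \<le> e\<^sup>2" if "p \<ge> M" for p N
    proof (rule LIMSEQ_le_const2)
      show "(\<lambda>q. \<Sum>n<N. (cmod (coord (X p) n - coord (X q) n))\<^sup>2)
              \<longlonglongrightarrow> (\<Sum>n<N. (cmod (coord (X p) n - L n))\<^sup>2)"
        by (intro tendsto_intros L)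
      have "(\<Sum>n<N. (cmod (coord (X p) n - coord (X q) n))\<^sup>2) \<le> e\<^sup>2" if "q \<ge> M" for q
      proof -
        have "(\<Sum>n<N. (cmod (coord (X p) n - coord (X q) n))\<^sup>2) \<le> (norm (X p - X q))\<^sup>2"
          using sum_coord_le_norm[of "X p - X q" N] by (simp add: minus_ell2.rep_eq)
        also have "\<dots> \<le> e\<^sup>2"
          using M[OF \<open>p \<ge> M\<close> \<open>q \<ge> M\<close>] by (intro power_mono) (auto simp: dist_norm)
        finally show ?thesis .
      qed
      then show "\<exists>M. \<forall>q\<ge>M. (\<Sum>n<N. (cmod (coord (X p) n - coord (X q) n))\<^sup>2) \<le> e\<^sup>2"
        by blast
    qed
    then show ?thesis by blast
  qed
  have summ: "summable (\<lambda>n. (cmod (coord (X p) n - L n))\<^sup>2)"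
    if "\<forall>N. (\<Sum>n<N. (cmod (coord (X p) n - L n))\<^sup>2) \<le> e\<^sup>2" for p e
    using that by (intro summableI_nonneg_bounded[where x = "e\<^sup>2"]) auto
  have "summable (\<lambda>n. (cmod (L n))\<^sup>2)"
  proof -
    obtain p where "summable (\<lambda>n. (cmod (coord (X p) n - L n))\<^sup>2)"
      using bound[of 1] summ by fastforce
    then have "summable (\<lambda>n. (cmod (L n - coord (X p) n))\<^sup>2)"
      by (simp add: norm_minus_commute)
    from square_summable_add[OF this summable_coord[of "X p"]] show ?thesis by simp
  qed
  then have cL: "coord (Abs_ell2 L) = L" by (simp add: Abs_ell2_inverse)
  have "X \<longlonglongrightarrow> Abs_ell2 L"
  proof (rule metric_LIMSEQ_I)
    fix e :: real assume "0 < e"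
    then obtain M where M: "\<forall>p\<ge>M. \<forall>N. (\<Sum>n<N. (cmod (coord (X p) n - L n))\<^sup>2) \<le> (e/2)\<^sup>2"
      using bound[of "e/2"] by auto
    have "dist (X p) (Abs_ell2 L) < e" if "p \<ge> M" for p
    proof -
      have "(norm (X p - Abs_ell2 L))\<^sup>2 \<le> (e/2)\<^sup>2"
        unfolding norm_ell2_power2 minus_ell2.rep_eq cL
        using M \<open>p \<ge> M\<close> by (intro suminf_le_const summ) auto
      then have "norm (X p - Abs_ell2 L) \<le> e/2"
        by (rule power2_le_imp_le) (use \<open>0 < e\<close> in simp)
      then show ?thesis using \<open>0 < e\<close> by (simp add: dist_norm)
    qed
    then show "\<exists>M. \<forall>p\<ge>M. dist (X p) (Abs_ell2 L) < e" by blast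
  qed
  then show "convergent X" by (auto simp: convergent_def)
qed

section \<open>Unilateral weighted shifts\<close>

lift_definition basis_vec :: "nat \<Rightarrow> ell2" is "\<lambda>n m. if m = n then 1 else 0"
proof -
  fix n :: nat
  show "summable (\<lambda>m. (cmod (if m = n then 1 else 0))\<^sup>2)"
    by (rule summable_finite[of "{n}"]) auto
qed

definition weighted_shift :: "(nat \<Rightarrow> real) \<Rightarrow> ell2 \<Rightarrow> ell2" where
  "weighted_shift \<alpha> =
     (THE W. bounded_clinear W \<and> (\<forall>n. W (basis_vec n) = \<alpha> n *\<^sub>R basis_vec (Suc n)))"

lemma basis_expansion: "(\<lambda>N. \<Sum>i<N. coord v i *\<^sub>C basis_vec i) \<longlonglongrightarrow> v"
proof -
  define P where "P N = (\<Sum>i<N. coord v i *\<^sub>C basis_vec i)" for N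
  have P: "coord (P N) n = (if n < N then coord v n else 0)" for N n
    unfolding P_def
    by (induction N)
       (auto simp: zero_ell2.rep_eq plus_ell2.rep_eq scaleC_ell2.rep_eq basis_vec.rep_eq less_Suc_eq)
  have "(norm (v - P N))\<^sup>2 = (\<Sum>n. (cmod (coord v (n + N)))\<^sup>2)" for N
  proof -
    have "(norm (v - P N))\<^sup>2 = (\<Sum>n. (cmod (coord (v - P N) (n + N)))\<^sup>2)
            + (\<Sum>n<N. (cmod (coord (v - P N) n))\<^sup>2)"
      unfolding norm_ell2_power2 by (rule suminf_split_initial_segment[OF summable_coord])
    then show ?thesis by (simp add: minus_ell2.rep_eq P)
  qed
  moreover have "(\<lambda>N. \<Sum>n. (cmod (coord v (n + N)))\<^sup>2) \<longlonglongrightarrow> 0"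
    by (rule suminf_exist_split2[OF summable_coord])
  ultimately have "(\<lambda>N. (norm (v - P N))\<^sup>2) \<longlonglongrightarrow> 0" by simp
  then have "(\<lambda>N. sqrt ((norm (v - P N))\<^sup>2)) \<longlonglongrightarrow> sqrt 0"
    by (intro tendsto_intros)
  then have "(\<lambda>N. norm (P N - v)) \<longlonglongrightarrow> 0"
    by (simp add: norm_minus_commute)
  then show ?thesis unfolding P_def by (simp add: tendsto_norm_zero_iff LIM_zero_iff)
qed

lemma bounded_clinear_eq_on_basis:
  fixes S T :: "ell2 \<Rightarrow> ell2"
  assumes "bounded_clinear S" "bounded_clinear T" "\<And>n. S (basis_vec n) = T (basis_vec n)"
  shows "S = T"
proof
  fix v
  define P where "P N = (\<Sum>i<N. coord v i *\<^sub>C basis_vec i)" for N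
  have bl: "bounded_linear S" "bounded_linear T" using assms by (auto simp: bounded_clinear_def)
  have "S (P N) = T (P N)" for N
    unfolding P_def using assms bl
    by (simp add: linear_sum[OF bounded_linear.linear] bounded_clinear_def)
  moreover have "P \<longlonglongrightarrow> v"
    using basis_expansion unfolding P_def .
  then have "(\<lambda>N. S (P N)) \<longlonglongrightarrow> S v" "(\<lambda>N. T (P N)) \<longlonglongrightarrow> T v"
    by (rule bounded_linear.tendsto[OF bl(1)], rule bounded_linear.tendsto[OF bl(2)])
  ultimately show "S v = T v"
    by (simp add: LIMSEQ_unique)
qed

lemma weighted_shift_exists:
  assumes "bounded (range \<alpha>)"
  obtains W where "bounded_clinear W"
    and "\<And>x n. coord (W x) n = (case n of 0 \<Rightarrow> 0 | Suc m \<Rightarrow> complex_of_real (\<alpha> m) * coord x m)"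
    and "\<And>n. W (basis_vec n) = \<alpha> n *\<^sub>R basis_vec (Suc n)"
proof -
  obtain B where B: "\<And>n. \<bar>\<alpha> n\<bar> \<le> B"
    using assms unfolding bounded_iff by auto
  then have B0: "0 \<le> B" by (meson abs_ge_zero order_trans)
  define s :: "ell2 \<Rightarrow> nat \<Rightarrow> complex" where
    "s x n = (case n of 0 \<Rightarrow> 0 | Suc m \<Rightarrow> complex_of_real (\<alpha> m) * coord x m)" for x n
  define W where "W x = Abs_ell2 (s x)" for x
  have le: "(cmod (s x (Suc n)))\<^sup>2 \<le> B\<^sup>2 * (cmod (coord x n))\<^sup>2" for x n
    using B[of n] B0 unfolding s_def
    by (auto simp: norm_mult power_mult_distrib abs_le_square_iff[symmetric]
        intro!: mult_right_mono)
  have sB: "summable (\<lambda>n. B\<^sup>2 * (cmod (coord x n))\<^sup>2)" for x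
    by (intro summable_mult summable_coord)
  have sS: "summable (\<lambda>n. (cmod (s x (Suc n)))\<^sup>2)" for x
    using le by (intro summable_comparison_test'[OF sB]) auto
  then have s: "summable (\<lambda>n. (cmod (s x n))\<^sup>2)" for x
    by (subst summable_Suc_iff[symmetric])
  have W: "coord (W x) n = (case n of 0 \<Rightarrow> 0 | Suc m \<Rightarrow> complex_of_real (\<alpha> m) * coord x m)" for x n
    using s unfolding W_def s_def by (simp add: Abs_ell2_inverse)
  have nW: "norm (W x) \<le> norm x * B" for x
  proof -
    have "(norm (W x))\<^sup>2 = (\<Sum>n. (cmod (s x n))\<^sup>2)"
      using s unfolding norm_ell2_power2 W_def by (simp add: Abs_ell2_inverse)
    also have "\<dots> = (\<Sum>n. (cmod (s x (Suc n)))\<^sup>2)"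
      by (subst suminf_split_head[OF s]) (simp add: s_def)
    also have "\<dots> \<le> (\<Sum>n. B\<^sup>2 * (cmod (coord x n))\<^sup>2)"
      by (rule suminf_le[OF le sS sB])
    also have "\<dots> = (norm x * B)\<^sup>2"
      unfolding power_mult_distrib norm_ell2_power2
      by (simp add: suminf_mult[OF summable_coord] mult.commute)
    finally show ?thesis by (rule power2_le_imp_le) (use B0 in simp)
  qed
  have "bounded_linear W"
    by (rule bounded_linear_intro[OF _ _ nW]; rule ell2_eqI)
       (auto simp: W plus_ell2.rep_eq scaleR_ell2.rep_eq algebra_simps split: nat.split)
  then have "bounded_clinear W"
    unfolding bounded_clinear_def
    by (auto intro!: ell2_eqI simp: W scaleC_ell2.rep_eq split: nat.split)
  moreover have "W (basis_vec n) = \<alpha> n *\<^sub>R basis_vec (Suc n)" for n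
    by (rule ell2_eqI) (auto simp: W scaleR_ell2.rep_eq basis_vec.rep_eq split: nat.split)
  ultimately show ?thesis using that W by blast
qed

lemma
  assumes "bounded (range \<alpha>)"
  shows bounded_clinear_weighted_shift: "bounded_clinear (weighted_shift \<alpha>)"
    and weighted_shift_basis: "weighted_shift \<alpha> (basis_vec n) = \<alpha> n *\<^sub>R basis_vec (Suc n)"
    and coord_weighted_shift: "coord (weighted_shift \<alpha> x) n =
          (case n of 0 \<Rightarrow> 0 | Suc m \<Rightarrow> complex_of_real (\<alpha> m) * coord x m)"
proof -
  obtain W where W: "bounded_clinear W"
    "\<And>x n. coord (W x) n = (case n of 0 \<Rightarrow> 0 | Suc m \<Rightarrow> complex_of_real (\<alpha> m) * coord x m)"
    "\<And>n. W (basis_vec n) = \<alpha> n *\<^sub>R basis_vec (Suc n)"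
    using weighted_shift_exists[OF assms] by blast
  have "weighted_shift \<alpha> = W"
    unfolding weighted_shift_def
    by (rule the_equality) (use W in \<open>auto intro: bounded_clinear_eq_on_basis\<close>)
  then show "bounded_clinear (weighted_shift \<alpha>)"
    "weighted_shift \<alpha> (basis_vec n) = \<alpha> n *\<^sub>R basis_vec (Suc n)"
    "coord (weighted_shift \<alpha> x) n =
       (case n of 0 \<Rightarrow> 0 | Suc m \<Rightarrow> complex_of_real (\<alpha> m) * coord x m)"
    using W by auto
qed

end

theory Submission
  imports Defs
begin

text \<open>
  The matrix \<open>M\<^sub>k(T)\<close> is the Schur complement of the identity in the top left corner of the matrix
  \<open>(T\<^sup>*\<^sup>j T\<^sup>i)\<close>, \<open>0 \<le> i, j \<le> k\<close>, so \<open>T\<close> is \<open>k\<close>-hyponormal if and only if the latter is positive.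
  Write \<open>E\<close> for the projection onto the span of \<open>e\<^sub>n\<close>, \<open>n > l\<close>, and \<open>A\<^sub>t = 1 + (t - 1) E\<close>. Then
  \<open>W\<^sub>t A\<^sub>t = A\<^sub>t W\<close> for the perturbed shift \<open>W\<^sub>t\<close>, and \<open>A\<^sub>t\<close> is invertible when \<open>t > 0\<close>; hence the
  positivity for \<open>W\<^sub>t\<close> says that \<open>\<Sum> \<langle>W\<^sup>i x\<^sub>j, W\<^sup>j x\<^sub>i\<rangle> + (t\<^sup>2 - 1) \<Sum> \<langle>E W\<^sup>i x\<^sub>j, E W\<^sup>j x\<^sub>i\<rangle> \<ge> 0\<close> for all
  \<open>x\<close>. This is a closed condition, and convex because it is affine in \<open>t\<^sup>2\<close>. Boundedness, and the
  failure for small \<open>t\<close> when \<open>l > 0\<close>, come from the monotonicity of the weights of a hyponormal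
  shift. When \<open>l = 0\<close>, \<open>t = 0\<close> always belongs to the set.
\<close>

section \<open>Positivity of the moment matrix\<close>

lemma cinner_add_right: "cinner x (y + z) = cinner x y + cinner x z"
  by (metis cinner_add_left cinner_commute complex_cnj_add)

lemma cinner_zero_left [simp]: "cinner 0 y = 0"
  using cinner_add_left[of 0 0 y] by simp

lemma cinner_zero_right [simp]: "cinner x 0 = 0"
  using cinner_add_right[of x 0 0] by simp

lemma cinner_diff_left: "cinner (x - y) z = cinner x z - cinner y z"
  by (metis add_diff_cancel_right' cinner_add_left diff_add_cancel)

lemma cinner_sum_left: "cinner (sum f A) y = (\<Sum>i\<in>A. cinner (f i) y)"
  by (induction A rule: infinite_finite_induct) (auto simp: cinner_add_left)

lemma cinner_sum_right: "cinner x (sum f A) = (\<Sum>i\<in>A. cinner x (f i))"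
  by (induction A rule: infinite_finite_induct) (auto simp: cinner_add_right)

lemma cinner_self: "cinner x x = complex_of_real ((norm x)\<^sup>2)"
proof (rule complex_eqI)
  show "Re (cinner x x) = Re (complex_of_real ((norm x)\<^sup>2))"
    by (simp add: Re_cinner power2_norm_eq_inner)
  have "cinner x x = cnj (cinner x x)"
    by (rule cinner_commute)
  then have "Im (cinner x x) = Im (cnj (cinner x x))"
    by (rule arg_cong)
  then show "Im (cinner x x) = Im (complex_of_real ((norm x)\<^sup>2))"
    by simp
qed

lemma cinner_self_nonneg: "cinner x x \<in> \<real>\<^sub>\<ge>\<^sub>0"
  by (simp add: cinner_self)

lemma cinner_funpow_adjoint:
  fixes T S :: "'a::complex_inner \<Rightarrow> 'a"
  assumes "\<And>x y. cinner (T x) y = cinner x (S y)"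
  shows "cinner ((T ^^ n) x) y = cinner x ((S ^^ n) y)"
  by (induction n arbitrary: y) (simp_all add: assms funpow_swap1[of S])

text \<open>The quadratic form of the operator matrix (T*^j T^i) with indices from 0 to k. Moving
  T*^j to the other side as T^j removes the adjoint, so only T itself has to be tracked under
  perturbation.\<close>

definition moment_form :: "nat \<Rightarrow> ('a::complex_inner \<Rightarrow> 'a) \<Rightarrow> (nat \<Rightarrow> 'a) \<Rightarrow> complex" where
  "moment_form k T x = (\<Sum>i\<le>k. \<Sum>j\<le>k. cinner ((T ^^ i) (x j)) ((T ^^ j) (x i)))"

text \<open>Completing the square in \<open>x 0\<close>: row and column 0 contribute <x0,x0> +
  <z,x0> + <x0,z>, and the missing <z,z> is exactly what the commutators subtract from the block
  with indices 1 to k.\<close>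

lemma moment_form_eq:
  fixes T S :: "'a::complex_inner \<Rightarrow> 'a" and k :: nat and x :: "nat \<Rightarrow> 'a"
  assumes adj: "\<And>x y. cinner (T x) y = cinner x (S y)"
  defines "z \<equiv> \<Sum>j=1..k. (S ^^ j) (x j)"
  shows "moment_form k T x =
    (\<Sum>i=1..k. cinner (\<Sum>j=1..k. commutator (S ^^ j) (T ^^ i) (x j)) (x i))
      + cinner (x 0 + z) (x 0 + z)"
proof -
  have TS: "cinner ((T ^^ n) u) v = cinner u ((S ^^ n) v)" for n u v
    by (rule cinner_funpow_adjoint[OF adj])
  have ST: "cinner ((S ^^ n) u) v = cinner u ((T ^^ n) v)" for n u v
    by (metis TS cinner_commute)
  have split: "(\<Sum>i\<le>k. f i) = f 0 + (\<Sum>i=1..k. f i)" for f :: "nat \<Rightarrow> complex"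
  proof -
    have "{..k} = insert 0 {1..k}" by auto
    then show ?thesis by simp
  qed
  have "(\<Sum>i=1..k. cinner (\<Sum>j=1..k. commutator (S ^^ j) (T ^^ i) (x j)) (x i))
      = (\<Sum>i=1..k. \<Sum>j=1..k. cinner ((T ^^ i) (x j)) ((T ^^ j) (x i)))
        - (\<Sum>i=1..k. \<Sum>j=1..k. cinner ((S ^^ j) (x j)) ((S ^^ i) (x i)))"
    by (simp add: cinner_sum_left commutator_def cinner_diff_left sum_subtractf ST TS)
  moreover have "(\<Sum>i=1..k. \<Sum>j=1..k. cinner ((S ^^ j) (x j)) ((S ^^ i) (x i)))
      = cinner (z) (z)"
    unfolding z_def by (simp add: cinner_sum_left cinner_sum_right)
  moreover have "moment_form k T x = cinner (x 0) (x 0)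
      + (\<Sum>j=1..k. cinner (x j) ((T ^^ j) (x 0))) + (\<Sum>i=1..k. cinner ((T ^^ i) (x 0)) (x i))
      + (\<Sum>i=1..k. \<Sum>j=1..k. cinner ((T ^^ i) (x j)) ((T ^^ j) (x i)))"
    unfolding moment_form_def split by (simp add: sum.distrib)
  moreover have "(\<Sum>j=1..k. cinner (x j) ((T ^^ j) (x 0))) = cinner (z) (x 0)"
    unfolding z_def by (simp add: cinner_sum_left ST)
  moreover have "(\<Sum>i=1..k. cinner ((T ^^ i) (x 0)) (x i)) = cinner (x 0) (z)"
    unfolding z_def by (simp add: cinner_sum_right TS)
  ultimately show ?thesis
    by (simp add: cinner_add_left cinner_add_right)
qed

lemma k_hyponormal_iff_moment_form:
  fixes T S :: "'a::chilbert_space \<Rightarrow> 'a"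
  assumes "bounded_clinear T" and adj: "\<And>x y. cinner (T x) y = cinner x (S y)"
  shows "k_hyponormal k T \<longleftrightarrow> (\<forall>x. moment_form k T x \<in> \<real>\<^sub>\<ge>\<^sub>0)"
proof -
  define H where
    "H x = (\<Sum>i=1..k. cinner (\<Sum>j=1..k. commutator (S ^^ j) (T ^^ i) (x j)) (x i))" for x
  define z where "z x = (\<Sum>j=1..k. (S ^^ j) (x j))" for x
  have eq: "moment_form k T x = H x + cinner (x 0 + z x) (x 0 + z x)" for x
    unfolding H_def z_def by (rule moment_form_eq[OF adj])
  have "cadjoint T = S"
    by (rule cadjoint_eqI[OF adj])
  then have "k_hyponormal k T \<longleftrightarrow> (\<forall>x. H x \<in> \<real>\<^sub>\<ge>\<^sub>0)"
    using assms by (simp add: k_hyponormal_def positive_semidefinite_matrix_def H_def)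
  also have "\<dots> \<longleftrightarrow> (\<forall>x. moment_form k T x \<in> \<real>\<^sub>\<ge>\<^sub>0)"
  proof
    assume "\<forall>x. H x \<in> \<real>\<^sub>\<ge>\<^sub>0"
    then show "\<forall>x. moment_form k T x \<in> \<real>\<^sub>\<ge>\<^sub>0"
      unfolding eq using cinner_self_nonneg nonneg_Reals_add_I by blast
  next
    assume M: "\<forall>x. moment_form k T x \<in> \<real>\<^sub>\<ge>\<^sub>0"
    show "\<forall>x. H x \<in> \<real>\<^sub>\<ge>\<^sub>0"
    proof
      fix x
      \<comment> \<open>This choice makes the square vanish. \<open>H\<close> and \<open>z\<close>
        only see indices from 1 on, so they do not notice the change at 0.\<close>
      let ?y = "x(0 := - z x)"
      have "z ?y = z x" "H ?y = H x"
        unfolding z_def H_def by (auto intro!: sum.cong arg_cong2[of _ _ _ _ cinner])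
      then have "moment_form k T ?y = H x"
        by (simp add: eq)
      then show "H x \<in> \<real>\<^sub>\<ge>\<^sub>0"
        using M by metis
    qed
  qed
  finally show ?thesis .
qed

text \<open>Testing \<open>M\<^sub>k(T)\<close> on a tuple supported at index 1 leaves only the
  entry [T*,T], so \<open>T\<close> is hyponormal.\<close>

lemma k_hyponormal_norm_adjoint_le:
  fixes T S :: "'a::chilbert_space \<Rightarrow> 'a"
  assumes "k_hyponormal k T" "k \<ge> 1" and adj: "\<And>x y. cinner (T x) y = cinner x (S y)"
  shows "norm (S u) \<le> norm (T u)"
proof -
  have lin: "linear T"
    using assms(1) by (auto simp: k_hyponormal_def bounded_clinear_def bounded_linear.linear)
  have T0: "(T ^^ n) 0 = 0" for n
    by (induction n) (simp_all add: linear_0[OF lin])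
  have S0: "S 0 = 0"
    using adj[of "S 0" 0] by (simp add: cinner_self)
  have Sn0: "(S ^^ n) 0 = 0" for n
    by (induction n) (simp_all add: S0)
  let ?x = "\<lambda>i::nat. if i = 1 then u else 0"
  have ST: "cinner (S a) b = cinner a (T b)" for a b
    by (metis adj cinner_commute)
  have "cadjoint T = S"
    by (rule cadjoint_eqI[OF adj])
  then have "(\<Sum>i=1..k. cinner (\<Sum>j=1..k. commutator (S ^^ j) (T ^^ i) (?x j)) (?x i)) \<in> \<real>\<^sub>\<ge>\<^sub>0"
    using assms(1) unfolding k_hyponormal_def positive_semidefinite_matrix_def by simp
  also have "(\<Sum>i=1..k. cinner (\<Sum>j=1..k. commutator (S ^^ j) (T ^^ i) (?x j)) (?x i))
      = (\<Sum>i=1..k. if i = 1 then cinner (\<Sum>j=1..k. commutator (S ^^ j) (T ^^ i) (?x j)) u else 0)"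
    by (intro sum.cong) auto
  also have "\<dots> = cinner (\<Sum>j=1..k. commutator (S ^^ j) T (?x j)) u"
    using \<open>k \<ge> 1\<close> by simp
  also have "(\<Sum>j=1..k. commutator (S ^^ j) T (?x j))
      = (\<Sum>j=1..k. if j = 1 then commutator (S ^^ j) T u else 0)"
    by (intro sum.cong) (auto simp: commutator_def linear_0[OF lin] Sn0)
  also have "\<dots> = commutator S T u"
    using \<open>k \<ge> 1\<close> by simp
  also have "cinner (commutator S T u) u = complex_of_real ((norm (T u))\<^sup>2 - (norm (S u))\<^sup>2)"
    by (simp add: commutator_def cinner_diff_left ST adj cinner_self)
  finally have "(norm (S u))\<^sup>2 \<le> (norm (T u))\<^sup>2"
    by (simp only: nonneg_Reals_of_real_iff diff_ge_0_iff_ge)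
  then show ?thesis
    by (rule power2_le_imp_le) simp
qed

section \<open>Weighted shifts\<close>

lemma weighted_shift_adjoint_exists:
  assumes "bounded (range \<alpha>)"
  obtains S where "\<And>x y. cinner (weighted_shift \<alpha> x) y = cinner x (S y)"
proof -
  obtain B where B: "\<And>n. \<bar>\<alpha> n\<bar> \<le> B"
    using assms unfolding bounded_iff by auto
  \<comment> \<open>The adjoint is the weighted backward shift.\<close>
  define s :: "ell2 \<Rightarrow> nat \<Rightarrow> complex" where
    "s y n = complex_of_real (\<alpha> n) * coord y (Suc n)" for y n
  have "summable (\<lambda>n. (cmod (s y n))\<^sup>2)" for y
  proof (rule summable_comparison_test')
    show "summable (\<lambda>n. B\<^sup>2 * (cmod (coord y (Suc n)))\<^sup>2)"
      by (intro summable_mult, subst summable_Suc_iff) (rule summable_coord)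
    show "norm ((cmod (s y n))\<^sup>2) \<le> B\<^sup>2 * (cmod (coord y (Suc n)))\<^sup>2" for n
      using power_mono[OF B[of n], of 2]
      by (auto simp: s_def norm_mult power_mult_distrib intro!: mult_right_mono)
  qed
  then have coord_s: "coord (Abs_ell2 (s y)) = s y" for y
    by (simp add: Abs_ell2_inverse)
  have "cinner (weighted_shift \<alpha> x) y = cinner x (Abs_ell2 (s y))" for x y
  proof -
    have "cinner (weighted_shift \<alpha> x) y =
        (\<Sum>n. coord (weighted_shift \<alpha> x) (Suc n) * cnj (coord y (Suc n)))"
      unfolding cinner_ell2_def
      by (subst suminf_split_head[OF summable_coord_cinner])
        (simp add: coord_weighted_shift[OF assms])
    then show ?thesis
      unfolding cinner_ell2_def
      by (simp add: coord_weighted_shift[OF assms] coord_s s_def mult_ac)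
  qed
  then show thesis
    by (rule that)
qed

lemma k_hyponormal_weighted_shift_iff:
  assumes "bounded (range \<alpha>)"
  shows "k_hyponormal k (weighted_shift \<alpha>) \<longleftrightarrow>
    (\<forall>x. moment_form k (weighted_shift \<alpha>) x \<in> \<real>\<^sub>\<ge>\<^sub>0)"
proof -
  obtain S where "\<And>x y. cinner (weighted_shift \<alpha> x) y = cinner x (S y)"
    using weighted_shift_adjoint_exists[OF assms] by blast
  then show ?thesis
    by (rule k_hyponormal_iff_moment_form[OF bounded_clinear_weighted_shift[OF assms]])
qed

lemma coord_eq_cinner_basis_vec: "coord x n = cinner x (basis_vec n)"
proof -
  have "cinner x (basis_vec n) = (\<Sum>m. if m = n then coord x m else 0)"
    unfolding cinner_ell2_def by (rule suminf_cong) (simp add: basis_vec.rep_eq)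
  also have "\<dots> = coord x n"
    using sums_unique[OF sums_single[of n "coord x"]] by simp
  finally show ?thesis by simp
qed

lemma norm_basis_vec: "norm (basis_vec n) = 1"
proof -
  have "complex_of_real ((norm (basis_vec n))\<^sup>2) = 1"
    by (simp only: cinner_self[symmetric] coord_eq_cinner_basis_vec[symmetric])
      (simp add: basis_vec.rep_eq)
  then show ?thesis
    by (metis norm_ge_zero of_real_eq_1_iff power2_eq_1_iff neg_0_le_iff_le not_one_le_zero)
qed

text \<open>Apply hyponormality to e_(n+1): the forward shift has norm |\<alpha>_(n+1)| there, and
  the adjoint has |\<alpha>_n| as modulus of its n-th coordinate.\<close>

lemma k_hyponormal_weights_mono:
  assumes "bounded (range \<alpha>)" "k_hyponormal k (weighted_shift \<alpha>)" "k \<ge> 1"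
  shows "\<bar>\<alpha> n\<bar> \<le> \<bar>\<alpha> (Suc n)\<bar>"
proof -
  let ?T = "weighted_shift \<alpha>" and ?e = "basis_vec (Suc n)"
  obtain S where adj: "\<And>x y. cinner (?T x) y = cinner x (S y)"
    using weighted_shift_adjoint_exists[OF assms(1)] by blast
  have "coord (S ?e) n = cnj (cinner (?T (basis_vec n)) ?e)"
    unfolding coord_eq_cinner_basis_vec adj by (rule cinner_commute)
  also have "cinner (?T (basis_vec n)) ?e = complex_of_real (\<alpha> n)"
    unfolding coord_eq_cinner_basis_vec[symmetric] weighted_shift_basis[OF assms(1)]
    by (simp add: scaleR_ell2.rep_eq basis_vec.rep_eq)
  finally have "\<bar>\<alpha> n\<bar> \<le> norm (S ?e)"
    using cmod_coord_le_norm[of "S ?e" n] by simp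
  also have "\<dots> \<le> norm (?T ?e)"
    by (rule k_hyponormal_norm_adjoint_le[OF assms(2,3) adj])
  also have "\<dots> = \<bar>\<alpha> (Suc n)\<bar>"
    by (simp add: weighted_shift_basis[OF assms(1)] norm_basis_vec)
  finally show ?thesis .
qed

section \<open>Perturbation of one weight\<close>

text \<open>The projection E of the overview; \<open>tail_scale l t\<close> is the operator
  \<open>A\<^sub>t\<close>.\<close>

lift_definition tail :: "nat \<Rightarrow> ell2 \<Rightarrow> ell2" is "\<lambda>l x n. if n \<le> l then 0 else x n"
  by (rule summable_comparison_test') auto

definition tail_scale :: "nat \<Rightarrow> real \<Rightarrow> ell2 \<Rightarrow> ell2" where
  "tail_scale l t x = x + (t - 1) *\<^sub>R tail l x"

lemma coord_tail_scale:
  "coord (tail_scale l t x) n = (if n \<le> l then 1 else complex_of_real t) * coord x n"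
  unfolding tail_scale_def plus_ell2.rep_eq scaleR_ell2.rep_eq tail.rep_eq
  by (simp add: algebra_simps)

lemma tail_scale_inverse: "t \<noteq> 0 \<Longrightarrow> tail_scale l t (tail_scale l (inverse t) x) = x"
  by (rule ell2_eqI) (simp add: coord_tail_scale)

text \<open>Each tail term of the inner product picks up one factor t from either side. This is why
  the parameter enters only through t^2.\<close>

lemma cinner_tail_scale:
  "cinner (tail_scale l t x) (tail_scale l t y)
    = cinner x y + complex_of_real (t\<^sup>2 - 1) * cinner (tail l x) (tail l y)"
proof -
  note sm = summable_coord_cinner
  have "cinner x y + complex_of_real (t\<^sup>2 - 1) * cinner (tail l x) (tail l y)
      = (\<Sum>n. coord x n * cnj (coord y n)
          + complex_of_real (t\<^sup>2 - 1) * (coord (tail l x) n * cnj (coord (tail l y) n)))"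
    unfolding cinner_ell2_def
    by (subst suminf_mult[OF sm, symmetric], rule suminf_add[OF sm summable_mult[OF sm]])
  also have "\<dots> = cinner (tail_scale l t x) (tail_scale l t y)"
    unfolding cinner_ell2_def
    by (rule suminf_cong)
      (auto simp: coord_tail_scale tail.rep_eq power2_eq_square algebra_simps)
  finally show ?thesis by simp
qed

lemma cinner_eq_tail_0: "cinner x y = coord x 0 * cnj (coord y 0) + cinner (tail 0 x) (tail 0 y)"
  unfolding cinner_ell2_def
  using suminf_split_head[OF summable_coord_cinner[of x y]]
    suminf_split_head[OF summable_coord_cinner[of "tail 0 x" "tail 0 y"]]
  by (simp add: tail.rep_eq diff_eq_eq add.commute)

lemma bounded_range_upd:
  fixes f :: "'a \<Rightarrow> 'b::metric_space"
  assumes "bounded (range f)"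
  shows "bounded (range (f(a := b)))"
proof (rule bounded_subset)
  show "bounded (insert b (range f))"
    using assms by simp
qed auto

text \<open>The two sides could differ only in the passage from coordinate l to l + 1. There the
  perturbed weight supplies the factor t that \<open>tail_scale\<close> supplies on the other
  side.\<close>

lemma weighted_shift_upd_tail_scale:
  assumes "bounded (range \<alpha>)"
  shows "(weighted_shift (\<alpha>(l := t * \<alpha> l)) ^^ i) (tail_scale l t x)
    = tail_scale l t ((weighted_shift \<alpha> ^^ i) x)"
proof -
  have "weighted_shift (\<alpha>(l := t * \<alpha> l)) (tail_scale l t x)
      = tail_scale l t (weighted_shift \<alpha> x)" for x
    by (rule ell2_eqI)
      (auto simp: coord_weighted_shift[OF assms] coord_tail_scale
        coord_weighted_shift[OF bounded_range_upd[OF assms]] not_le less_Suc_eq_le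
        dest: le_antisym split: nat.split)
  then show ?thesis
    by (induction i) simp_all
qed

section \<open>The positivity condition as an affine function of t^2\<close>

definition tail_form :: "nat \<Rightarrow> nat \<Rightarrow> (nat \<Rightarrow> real) \<Rightarrow> (nat \<Rightarrow> ell2) \<Rightarrow> complex" where
  "tail_form k l \<alpha> x = (\<Sum>i\<le>k. \<Sum>j\<le>k.
     cinner (tail l ((weighted_shift \<alpha> ^^ i) (x j))) (tail l ((weighted_shift \<alpha> ^^ j) (x i))))"

text \<open>The parameter \<open>s\<close> stands for t^2. The form is affine in \<open>s\<close>
  and still makes sense at s = 0, where \<open>A\<^sub>t\<close> is not invertible.\<close>

definition perturbed_form ::
    "nat \<Rightarrow> nat \<Rightarrow> (nat \<Rightarrow> real) \<Rightarrow> real \<Rightarrow> (nat \<Rightarrow> ell2) \<Rightarrow> complex" where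
  "perturbed_form k l \<alpha> s x =
     moment_form k (weighted_shift \<alpha>) x + complex_of_real (s - 1) * tail_form k l \<alpha> x"

lemma moment_form_upd_tail_scale:
  assumes "bounded (range \<alpha>)"
  shows "moment_form k (weighted_shift (\<alpha>(l := t * \<alpha> l))) (\<lambda>j. tail_scale l t (x j))
    = perturbed_form k l \<alpha> (t\<^sup>2) x"
  unfolding moment_form_def perturbed_form_def tail_form_def
  by (simp add: weighted_shift_upd_tail_scale[OF assms] cinner_tail_scale sum.distrib
      sum_distrib_left)

text \<open>For t > 0 every tuple is the image of a tuple under \<open>tail_scale l t\<close>, so
  testing on such images loses nothing.\<close>

lemma k_hyponormal_upd_iff_pos:
  assumes "bounded (range \<alpha>)" "t > 0"
  shows "k_hyponormal k (weighted_shift (\<alpha>(l := t * \<alpha> l))) \<longleftrightarrow>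
    (\<forall>x. perturbed_form k l \<alpha> (t\<^sup>2) x \<in> \<real>\<^sub>\<ge>\<^sub>0)"
  unfolding k_hyponormal_weighted_shift_iff[OF bounded_range_upd[OF assms(1)]]
proof safe
  let ?T = "weighted_shift (\<alpha>(l := t * \<alpha> l))"
  fix x :: "nat \<Rightarrow> ell2"
  show "perturbed_form k l \<alpha> (t\<^sup>2) x \<in> \<real>\<^sub>\<ge>\<^sub>0" if "\<forall>x. moment_form k ?T x \<in> \<real>\<^sub>\<ge>\<^sub>0"
    using that moment_form_upd_tail_scale[OF assms(1)] by metis
  assume "\<forall>x. perturbed_form k l \<alpha> (t\<^sup>2) x \<in> \<real>\<^sub>\<ge>\<^sub>0"
  then have "moment_form k ?T (\<lambda>j. tail_scale l t (tail_scale l (inverse t) (x j))) \<in> \<real>\<^sub>\<ge>\<^sub>0"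
    using moment_form_upd_tail_scale[OF assms(1)] by metis
  then show "moment_form k ?T x \<in> \<real>\<^sub>\<ge>\<^sub>0"
    using \<open>t > 0\<close> by (simp add: tail_scale_inverse)
qed

lemma perturbed_form_convex:
  assumes "\<forall>x. perturbed_form k l \<alpha> a x \<in> \<real>\<^sub>\<ge>\<^sub>0" "\<forall>x. perturbed_form k l \<alpha> b x \<in> \<real>\<^sub>\<ge>\<^sub>0"
    and "a \<le> s" "s \<le> b"
  shows "\<forall>x. perturbed_form k l \<alpha> s x \<in> \<real>\<^sub>\<ge>\<^sub>0"
proof
  fix x
  have "s \<in> closed_segment a b"
    using assms by (simp add: closed_segment_eq_real_ivl)
  then obtain u where u: "0 \<le> u" "u \<le> 1" "s = (1 - u) * a + u * b"
    by (auto simp: closed_segment_def)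
  have "perturbed_form k l \<alpha> s x = complex_of_real (1 - u) * perturbed_form k l \<alpha> a x
      + complex_of_real u * perturbed_form k l \<alpha> b x"
    unfolding perturbed_form_def u(3) by (simp add: algebra_simps)
  also have "\<dots> \<in> \<real>\<^sub>\<ge>\<^sub>0"
    using assms u
    by (intro nonneg_Reals_add_I nonneg_Reals_mult_I) (auto simp del: of_real_diff)
  finally show "perturbed_form k l \<alpha> s x \<in> \<real>\<^sub>\<ge>\<^sub>0" .
qed

section \<open>The endpoint t = 0\<close>

lemma coord_weighted_shift_funpow_0:
  assumes "bounded (range \<alpha>)"
  shows "coord ((weighted_shift \<alpha> ^^ i) x) 0 = (if i = 0 then coord x 0 else 0)"
  by (cases i) (auto simp: coord_weighted_shift[OF assms])

text \<open>The first factor forces i = 0 and the second j = 0, so one term survives. The sum is the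
  contribution of coordinate 0 to a moment form.\<close>

lemma sum_first_row_column:
  "(\<Sum>i\<le>k. \<Sum>j\<le>k. (if i = 0 then f j else 0) * cnj (if j = 0 then f i else 0))
    = complex_of_real ((cmod (f 0))\<^sup>2)" for f :: "nat \<Rightarrow> complex"
proof -
  have "(\<Sum>i\<le>k. \<Sum>j\<le>k. (if i = 0 then f j else 0) * cnj (if j = 0 then f i else 0))
      = (\<Sum>i\<le>k. \<Sum>j\<le>k. if j = 0 then if i = 0 then f 0 * cnj (f 0) else 0 else 0)"
    by (intro sum.cong) auto
  also have "\<dots> = f 0 * cnj (f 0)"
    by simp
  finally show ?thesis
    by (simp only: complex_norm_square)
qed

lemma perturbed_form_0_0:
  assumes "bounded (range \<alpha>)"
  shows "perturbed_form k 0 \<alpha> 0 x = complex_of_real ((cmod (coord (x 0) 0))\<^sup>2)"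
proof -
  have "moment_form k (weighted_shift \<alpha>) x =
      (\<Sum>i\<le>k. \<Sum>j\<le>k. (if i = 0 then coord (x j) 0 else 0) * cnj (if j = 0 then coord (x i) 0 else 0))
        + tail_form k 0 \<alpha> x"
    unfolding moment_form_def tail_form_def sum.distrib[symmetric]
    by (intro sum.cong refl, subst cinner_eq_tail_0)
      (simp add: coord_weighted_shift_funpow_0[OF assms])
  then show ?thesis
    unfolding sum_first_row_column by (simp add: perturbed_form_def)
qed

text \<open>With weight 0 set to zero, the shift splits into the zero operator on the span of e_0
  and the restriction of the original shift to the tail. The moment form splits accordingly into a
  square and a value of the original form.\<close>

lemma k_hyponormal_upd_0_0:
  assumes "bounded (range \<alpha>)" "k_hyponormal k (weighted_shift \<alpha>)"
  shows "k_hyponormal k (weighted_shift (\<alpha>(0 := 0)))"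
  unfolding k_hyponormal_weighted_shift_iff[OF bounded_range_upd[OF assms(1)]]
proof
  fix x :: "nat \<Rightarrow> ell2"
  let ?W = "weighted_shift \<alpha>" and ?T = "weighted_shift (\<alpha>(0 := 0))"
  let ?y = "\<lambda>j. tail 0 (x j)"
  note bdd = bounded_range_upd[OF assms(1)]
  \<comment> \<open>The new shift sends coordinate 0 to zero, and every shift has range in the tail;
    together, \<open>tail 0\<close> intertwines \<open>?T\<close> with \<open>?W\<close>.\<close>
  have "tail 0 (?T v) = tail 0 (?W (tail 0 v))" and W: "tail 0 (?W v) = ?W v" for v
    by (rule ell2_eqI, auto simp: tail.rep_eq coord_weighted_shift[OF bdd]
        coord_weighted_shift[OF assms(1)] split: nat.split)+
  then have "tail 0 ((?T ^^ i) v) = (?W ^^ i) (tail 0 v)" for i v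
    by (induction i) simp_all
  moreover have "tail 0 ((?W ^^ i) (tail 0 v)) = (?W ^^ i) (tail 0 v)" for i v
    by (cases i) (auto simp: W intro: ell2_eqI simp: tail.rep_eq)
  ultimately have "moment_form k ?T x =
      (\<Sum>i\<le>k. \<Sum>j\<le>k. (if i = 0 then coord (x j) 0 else 0) * cnj (if j = 0 then coord (x i) 0 else 0))
        + moment_form k ?W ?y"
    unfolding moment_form_def sum.distrib[symmetric]
    by (intro sum.cong refl, subst cinner_eq_tail_0)
      (simp add: coord_weighted_shift_funpow_0[OF bdd])
  moreover have "moment_form k ?W ?y \<in> \<real>\<^sub>\<ge>\<^sub>0"
    using assms k_hyponormal_weighted_shift_iff by blast
  ultimately show "moment_form k ?T x \<in> \<real>\<^sub>\<ge>\<^sub>0"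
    unfolding sum_first_row_column by (simp add: nonneg_Reals_add_I)
qed

text \<open>At t = 0 the argument by invertibility fails. Both sides turn out true if l = 0 and
  false if l > 0.\<close>

lemma k_hyponormal_upd_iff:
  assumes "k \<ge> 1" "\<forall>n. \<alpha> n > 0" "bounded (range \<alpha>)" "k_hyponormal k (weighted_shift \<alpha>)" "t \<ge> 0"
  shows "k_hyponormal k (weighted_shift (\<alpha>(l := t * \<alpha> l))) \<longleftrightarrow>
    (\<forall>x. perturbed_form k l \<alpha> (t\<^sup>2) x \<in> \<real>\<^sub>\<ge>\<^sub>0)"
proof (cases "t = 0")
  case False
  then show ?thesis
    using k_hyponormal_upd_iff_pos assms by simp
next
  case t0: True
  show ?thesis
  proof (cases l)
    case 0
    then show ?thesis
      using t0 k_hyponormal_upd_0_0[OF assms(3,4)] perturbed_form_0_0[OF assms(3)] by simp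
  next
    case (Suc m)
    have lower: "\<alpha> m \<le> s * \<alpha> l"
      if "s \<ge> 0" "k_hyponormal k (weighted_shift (\<alpha>(l := s * \<alpha> l)))" for s
      using k_hyponormal_weights_mono[OF bounded_range_upd[OF assms(3)] that(2) assms(1), of m]
        assms(2) that(1) Suc by (simp add: abs_mult less_imp_le)
    have pos: "\<alpha> m > 0" "\<alpha> l > 0"
      using assms(2) by auto
    have "\<not> (\<forall>x. perturbed_form k l \<alpha> 0 x \<in> \<real>\<^sub>\<ge>\<^sub>0)"
    proof
      assume z: "\<forall>x. perturbed_form k l \<alpha> 0 x \<in> \<real>\<^sub>\<ge>\<^sub>0"
      have one: "\<forall>x. perturbed_form k l \<alpha> 1 x \<in> \<real>\<^sub>\<ge>\<^sub>0"
        using assms(3,4) by (simp add: perturbed_form_def k_hyponormal_weighted_shift_iff)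
      \<comment> \<open>Positive, so that the case t > 0 applies; at most 1, so that
        \<open>s\<^sup>2\<close> lies between the two good parameters 0 and 1; and small enough that
        s \<alpha>_l stays below the preceding weight.\<close>
      define s where "s = min 1 (\<alpha> m / (2 * \<alpha> l))"
      have s: "0 < s" "s \<le> 1" "s \<le> \<alpha> m / (2 * \<alpha> l)"
        using pos by (auto simp: s_def)
      have "s\<^sup>2 \<le> 1"
        using s by (simp add: power_le_one)
      then have "\<forall>x. perturbed_form k l \<alpha> (s\<^sup>2) x \<in> \<real>\<^sub>\<ge>\<^sub>0"
        using perturbed_form_convex[OF z one] by simp
      then have "\<alpha> m \<le> s * \<alpha> l"
        using lower k_hyponormal_upd_iff_pos[OF assms(3)] s by simp
      also have "\<dots> \<le> \<alpha> m / (2 * \<alpha> l) * \<alpha> l"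
        using s pos by (intro mult_right_mono) auto
      also have "\<dots> < \<alpha> m"
        using pos by simp
      finally show False by simp
    qed
    moreover have "\<not> k_hyponormal k (weighted_shift (\<alpha>(l := t * \<alpha> l)))"
      using lower[of t] t0 pos by auto
    ultimately show ?thesis
      using t0 by simp
  qed
qed

section \<open>The set of parameters is a nonempty compact interval\<close>

theorem theorem3p6:
  fixes k l :: nat and \<alpha> :: "nat \<Rightarrow> real"
  assumes "k \<ge> 1"
    and "\<forall>n. \<alpha> n > 0"
    and "bounded (range \<alpha>)"
    and "k_hyponormal k (weighted_shift \<alpha>)"
  shows "\<exists>a b. a \<le> b \<and>
    {t :: real. t \<ge> 0 \<and> k_hyponormal k (weighted_shift (\<alpha>(l := t * \<alpha> l)))} = {a..b}"
proof -
  let ?I = "{t :: real. t \<ge> 0 \<and> k_hyponormal k (weighted_shift (\<alpha>(l := t * \<alpha> l)))}"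
  have I: "?I = {t. t \<ge> 0 \<and> (\<forall>x. perturbed_form k l \<alpha> (t\<^sup>2) x \<in> \<real>\<^sub>\<ge>\<^sub>0)}"
    using k_hyponormal_upd_iff[OF assms] by blast
  \<comment> \<open>For each fixed \<open>x\<close> the form is continuous in t and must lie in a
    closed set; \<open>?I\<close> is an intersection of such conditions.\<close>
  have "closed ?I"
    unfolding I perturbed_form_def
    by (intro closed_Collect_conj closed_Collect_all closed_Collect_le
        closed_vimage[OF closed_nonneg_Reals_complex, unfolded vimage_def] continuous_intros)
  \<comment> \<open>The bound compares the perturbed weight l with its successor.\<close>
  moreover have "?I \<subseteq> {0..\<alpha> (Suc l) / \<alpha> l}"
  proof
    fix t assume t: "t \<in> ?I"
    then have "\<bar>t * \<alpha> l\<bar> \<le> \<bar>\<alpha> (Suc l)\<bar>"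
      using k_hyponormal_weights_mono[OF bounded_range_upd[OF assms(3)] _ assms(1), of l "t * \<alpha> l" l]
      by simp
    then show "t \<in> {0..\<alpha> (Suc l) / \<alpha> l}"
      using t assms(2) by (simp add: abs_mult less_imp_le pos_le_divide_eq)
  qed
  then have "bounded ?I"
    using bounded_closed_interval bounded_subset by blast
  moreover have "is_interval ?I"
    unfolding is_interval_1
  proof (intro ballI allI impI)
    fix a b t assume a: "a \<in> ?I" and b: "b \<in> ?I" and t: "a \<le> t \<and> t \<le> b"
    have "a\<^sup>2 \<le> t\<^sup>2" "t\<^sup>2 \<le> b\<^sup>2"
      using a t by (auto intro: power_mono)
    then show "t \<in> ?I"
      using a b t perturbed_form_convex[of k l \<alpha> "a\<^sup>2" "b\<^sup>2" "t\<^sup>2"] unfolding I by auto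
  qed
  ultimately obtain a b where ab: "?I = {a..b}"
    using connected_compact_interval_1 compact_eq_bounded_closed is_interval_connected by metis
  \<comment> \<open>t = 1 gives back \<alpha>; without a member, {a..b} could be empty with b <
    a.\<close>
  have "1 \<in> ?I"
    using assms(4) by simp
  then have "a \<le> b"
    unfolding ab by simp
  with ab show ?thesis
    by blast
qed

end
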